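(* Let $K$ be a field and let $\mathcal M=(\mu_{i,j})$ be a matrix of natural numbers with $3$ columns, indexed by $i=1,2,3$, and rows indexed by $j=1,2,3,\ldots$. Then $\mathcal M$ is the matrix of generators of a strongly stable monomial ideal $I\subset K[x_1,x_2,x_3]$ if and only if the following conditions hold: (1) Each non-zero row vector $(\mu_{1,j},\mu_{2,j},\mu_{3,j})$ of $\mathcal M$ is an $O$-sequence with $\mu_{2,j}\le j$. (2) For all $j$ one has $\mu_{2,j}\ge\mu_{1,j-1}+\mu_{2,j-1}$ and $\mu_{3,j}\ge\mu_{1,j-1}+\mu_{2,j-1}+\mu_{3,j-1}$.
   Context: A monomial ideal $I$ in $S=K[x_1,x_2,x_3]$ is strongly stable if for every monomial $u\in I$, every $j$ such that $x_j$ divides $u$, and every $i<j$, one has $(u/x_j)x_i\in I$. For a monomial $u\neq1$, $m(u)$ is the largest index $e$ such that $x_e$ divides $u$. For a strongly stable ideal $J$ with minimal set of monomial generators $G(J)$, $m_i(J)$ is the number of $u\in G(J)$ with $m(u)=i$. For an ideal $I$, $I_{\langle j\rangle}$ is the ideal generated by the degree-$j$ elements of $I$. The matrix of generators of a strongly stable ideal $I$ is the matrix $\mathcal M(I)=(\mu_{i,j}(I))$ with $\mu_{i,j}(I)=m_i(I_{\langle j\rangle})$, where $i=1,2,3$ indexes columns and $j=1,2,3,\ldots$ indexes rows; by convention $\mu_{i,0}=0$. For a natural number $a$ and a positive integer $d$, with $d$-th Macaulay representation $a=\sum_{i=1}^d\binom{k(i)}{i}$, $k(d)>k(d-1)>\cdots>k(1)\ge0$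 (which is unique), set $a^{\langle d\rangle}=\sum_{i=1}^d\binom{k(i)+1}{i+1}$. A vector $(m_1,\ldots,m_n)$ of natural numbers is an $O$-sequence if $m_1=1$ and $m_{i+1}\le m_i^{\langle i-1\rangle}$ for all $i=2,\ldots,n-1$. *)

theory Defs
  imports Complex_Main "HOL-Library.Poly_Mapping"
begin

text \<open>
  The polynomial ring $K[x_v : v \in V]$ is the type \<open>('v, 'k) mpoly\<close>: finitely supported
  coefficient functions on exponent vectors, with the convolution product of \<open>Poly_Mapping\<close>.
  Monomials are identified with their exponent vectors; \<open>mon t\<close> is the monomial as a polynomial.
\<close>

type_synonym 'v expv = "'v \<Rightarrow>\<^sub>0 nat"
type_synonym ('v, 'k) mpoly = "'v expv \<Rightarrow>\<^sub>0 'k"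

datatype var3 = X1 | X2 | X3

fun var_index :: "var3 \<Rightarrow> nat" where
  "var_index X1 = 1"
| "var_index X2 = 2"
| "var_index X3 = 3"

instantiation var3 :: linorder
begin

definition less_eq_var3 :: "var3 \<Rightarrow> var3 \<Rightarrow> bool" where
  "i \<le> j \<longleftrightarrow> var_index i \<le> var_index j"

definition less_var3 :: "var3 \<Rightarrow> var3 \<Rightarrow> bool" where
  "i < j \<longleftrightarrow> var_index i < var_index j"

instance
proof
  fix x y z :: var3
  show "x < y \<longleftrightarrow> x \<le> y \<and> \<not> y \<le> x"
    by (auto simp: less_eq_var3_def less_var3_def)
  show "x \<le> x" "x \<le> y \<or> y \<le> x"
    by (auto simp: less_eq_var3_def)
  show "x \<le> z" if "x \<le> y" "y \<le> z"
    using that by (auto simp: less_eq_var3_def)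
  show "x = y" if "x \<le> y" "y \<le> x"
    using that by (cases x; cases y) (auto simp: less_eq_var3_def)
qed

end

text \<open>
  A commutative ring is a module over itself, its submodules are the ideals:
  \<open>ideal.span B\<close> is the ideal generated by \<open>B\<close>.
\<close>

global_interpretation ideal: module "(*) :: 'a::comm_ring_1 \<Rightarrow> 'a \<Rightarrow> 'a"
  by standard (simp_all add: algebra_simps)

definition mon :: "'v expv \<Rightarrow> ('v, 'k::field) mpoly" where
  "mon t = Poly_Mapping.single t 1"

definition expv_degree :: "'v expv \<Rightarrow> nat" where
  "expv_degree t = (\<Sum>v\<in>Poly_Mapping.keys t. Poly_Mapping.lookup t v)"

definition homogeneous :: "nat \<Rightarrow> ('v, 'k::field) mpoly \<Rightarrow> bool" where
  "homogeneous d f \<longleftrightarrow> (\<forall>t\<in>Poly_Mapping.keys f. expv_degree t = d)"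

definition monomial_ideal :: "('v, 'k::field) mpoly set \<Rightarrow> bool" where
  "monomial_ideal I \<longleftrightarrow> (\<exists>A. I = ideal.span (mon ` A))"

text \<open>
  The variable $x_j$ divides the monomial with exponent vector \<open>u\<close> iff \<open>j \<in> keys u\<close>, and then
  $(u/x_j)x_i$ has the exponent vector displayed below.
\<close>

definition strongly_stable :: "('v::linorder, 'k::field) mpoly set \<Rightarrow> bool" where
  "strongly_stable I \<longleftrightarrow> monomial_ideal I \<and>
     (\<forall>u. mon u \<in> I \<longrightarrow>
        (\<forall>j\<in>Poly_Mapping.keys u. \<forall>i<j.
           mon (u - Poly_Mapping.single j 1 + Poly_Mapping.single i 1) \<in> I))"

text \<open>
  The minimal set $G(J)$ of monomial generators of a monomial ideal, as a set of exponent vectors.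
  Minimality is with respect to inclusion; such a set is unique for a monomial ideal.
\<close>

definition min_gens :: "('v, 'k::field) mpoly set \<Rightarrow> 'v expv set" where
  "min_gens J = (THE A. ideal.span (mon ` A) = J \<and> (\<forall>B. B \<subset> A \<longrightarrow> ideal.span (mon ` B) \<noteq> J))"

definition max_var :: "'v::linorder expv \<Rightarrow> 'v" where
  "max_var u = Max (Poly_Mapping.keys u)"

definition num_gens :: "'v::linorder \<Rightarrow> ('v, 'k::field) mpoly set \<Rightarrow> nat" where
  "num_gens i J = card {u \<in> min_gens J. u \<noteq> 0 \<and> max_var u = i}"

definition degree_part_ideal :: "('v, 'k::field) mpoly set \<Rightarrow> nat \<Rightarrow> ('v, 'k) mpoly set" where
  "degree_part_ideal I j = ideal.span {f \<in> I. homogeneous j f}"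

text \<open>Columns are indexed by the first argument, rows by the second one; row $0$ is zero by convention.\<close>

definition gen_matrix :: "('v::linorder, 'k::field) mpoly set \<Rightarrow> 'v \<Rightarrow> nat \<Rightarrow> nat" where
  "gen_matrix I i j = (if j = 0 then 0 else num_gens i (degree_part_ideal I j))"

definition macaulay_rep :: "nat \<Rightarrow> nat \<Rightarrow> (nat \<Rightarrow> nat) \<Rightarrow> bool" where
  "macaulay_rep a d k \<longleftrightarrow>
     (\<forall>i\<in>{1..d}. \<forall>j\<in>{1..d}. i < j \<longrightarrow> k i < k j) \<and> a = (\<Sum>i=1..d. k i choose i)"

text \<open>
  The number $a^{\langle d\rangle}$, meaningful for \<open>d \<ge> 1\<close>. The representation \<open>k\<close> is unique only
  on \<open>{1..d}\<close>, hence the description of the value and not of \<open>k\<close>.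
\<close>

definition macaulay_up :: "nat \<Rightarrow> nat \<Rightarrow> nat" where
  "macaulay_up a d =
     (THE b. \<exists>k. macaulay_rep a d k \<and> b = (\<Sum>i=1..d. (k i + 1) choose (i + 1)))"

text \<open>The entry $m_i$ of the vector $(m_1,\ldots,m_n)$ is \<open>ms ! (i - 1)\<close>.\<close>

definition O_sequence :: "nat list \<Rightarrow> bool" where
  "O_sequence ms \<longleftrightarrow> ms \<noteq> [] \<and> ms ! 0 = 1 \<and>
     (\<forall>i\<in>{2..length ms - 1}. ms ! i \<le> macaulay_up (ms ! (i - 1)) (i - 1))"

end

theory Submission
  imports Defs
begin

text \<open>
  For a monomial ideal \<open>I\<close>, the minimal generators of \<open>degree_part_ideal I d\<close> are all monomials of
  degree \<open>d\<close> in \<open>I\<close> (\<open>min_gens_degree_part\<close>), so row \<open>d\<close> of the matrix counts these monomials by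
  their largest variable. Writing a monomial $x_1^{d-b-c} x_2^b x_3^c$ as the pair $(b,c)$ turns
  the degree \<open>d\<close> part of \<open>I\<close> into a set $E_d$ of pairs in the triangle $b+c\le d$. Strong stability
  becomes the rule that $(b+1,c)\in E_d$ implies $(b,c)\in E_d$ and that $(b,c+1)\in E_d$ implies
  $(b+1,c)\in E_d$; for families of such sets, closure under multiplication reduces to closure
  under multiplication by $x_3$, that is, $(b,c)\in E_d$ implies $(b,c+1)\in E_{d+1}$.

  Necessity. A nonempty stable set contains $(0,0)$, so the first entry of a nonzero row is $1$.
  If its second entry is $m$, then $(b,0)\in E_d$ exactly for $b\le m$, whence $m \le d$. As
  $(b,c)\in E_d$ forces $(b+c,0)\in E_d$, the set lies in the triangle $b+c\le m$, which has
  $\binom{m+1}{2}$ pairs with $c>0$. This is the \<open>O\<close>-sequence bound, because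
  $m^{\langle 1\rangle}=\binom{m+1}{2}$. Condition (2) counts $x_2u$ for $u$ not divisible by
  $x_3$, and $x_3u$ for all $u$ (\<open>pairs_growth\<close>).

  Sufficiency. The sets $E_d$ are chosen recursively. The row $(1,m,n)$ of degree $d+1$ requires
  the pairs $(b,0)$ with $b\le m$, and $E_d$ requires its translate by $(0,1)$; together these form
  a stable set. By (2) it lies in the triangle $b+c\le m$ and has at most $1+m+n$ elements, and by
  (1) the triangle has at least that many. Any stable set inside a larger finite stable set can be
  enlarged by one element at a time (\<open>stable_pairs_extend\<close>), so there is a stable set of exactly
  $1+m+n$ elements between the two (\<open>stable_pairs_next\<close>). The monomials encoded by the $E_d$
  generate the ideal sought.
\<close>

section \<open>Monomial ideals and their homogeneous parts\<close>

lemma keys_in_monomial_span: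
  assumes "f \<in> ideal.span (mon ` A :: ('v, 'k::field) mpoly set)" and "t \<in> Poly_Mapping.keys f"
  shows "\<exists>a\<in>A. \<exists>s. t = s + a"
proof -
  let ?W = "{f :: ('v, 'k) mpoly. \<forall>t\<in>Poly_Mapping.keys f. \<exists>a\<in>A. \<exists>s. t = s + a}"
  have "ideal.subspace ?W"
  proof (rule ideal.subspaceI)
    fix f g :: "('v, 'k) mpoly"
    assume "f \<in> ?W" "g \<in> ?W"
    then show "f + g \<in> ?W"
      using Poly_Mapping.keys_add[of f g] by blast
  next
    fix c f :: "('v, 'k) mpoly"
    assume f: "f \<in> ?W"
    have "\<exists>a\<in>A. \<exists>s. t = s + a" if t: "t \<in> Poly_Mapping.keys (c * f)" for t
    proof -
      obtain p q where "t = p + q" "q \<in> Poly_Mapping.keys f"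
        using t Poly_Mapping.keys_mult[of c f] by blast
      moreover from this obtain a s where "a \<in> A" "q = s + a"
        using f by blast
      ultimately have "t = (p + s) + a"
        by (simp add: add.assoc)
      with \<open>a \<in> A\<close> show ?thesis by blast
    qed
    then show "c * f \<in> ?W" by blast
  qed simp
  moreover have "mon ` A \<subseteq> ?W"
    by (force simp: mon_def intro: exI[of _ 0])
  ultimately have "ideal.span (mon ` A) \<subseteq> ?W"
    by (rule ideal.span_minimal[rotated])
  then show ?thesis using assms by blast
qed

lemma mon_add: "mon (s + t) = mon s * mon t"
  by (simp add: mon_def mult_single)

lemma mon_in_span_iff:
  "(mon t :: ('v, 'k::field) mpoly) \<in> ideal.span (mon ` A) \<longleftrightarrow> (\<exists>a\<in>A. \<exists>s. t = s + a)"
proof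
  assume "(mon t :: ('v, 'k) mpoly) \<in> ideal.span (mon ` A)"
  then show "\<exists>a\<in>A. \<exists>s. t = s + a"
    by (rule keys_in_monomial_span) (simp add: mon_def)
next
  assume "\<exists>a\<in>A. \<exists>s. t = s + a"
  then show "(mon t :: ('v, 'k) mpoly) \<in> ideal.span (mon ` A)"
    by (auto simp: mon_add intro!: ideal.span_scale[OF ideal.span_base])
qed

lemma sum_terms:
  "(\<Sum>t\<in>Poly_Mapping.keys f. Poly_Mapping.single 0 (Poly_Mapping.lookup f t) * mon t) = (f :: ('v, 'k::field) mpoly)"
proof (rule poly_mapping_eqI)
  fix u
  show "Poly_Mapping.lookup (\<Sum>t\<in>Poly_Mapping.keys f.
      Poly_Mapping.single 0 (Poly_Mapping.lookup f t) * mon t) u = Poly_Mapping.lookup f u"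
    by (simp add: mon_def mult_single lookup_sum lookup_single when_def in_keys_iff)
qed

lemma in_span_if_keys:
  fixes f :: "('v, 'k::field) mpoly"
  assumes "\<And>t. t \<in> Poly_Mapping.keys f \<Longrightarrow> mon t \<in> ideal.span B"
  shows "f \<in> ideal.span B"
proof -
  have "(\<Sum>t\<in>Poly_Mapping.keys f. Poly_Mapping.single 0 (Poly_Mapping.lookup f t) * mon t)
      \<in> ideal.span B"
    using assms by (intro ideal.span_sum ideal.span_scale)
  then show ?thesis by (simp only: sum_terms)
qed

lemma keys_in_monomial_ideal:
  assumes "monomial_ideal I" "f \<in> I" "t \<in> Poly_Mapping.keys f"
  shows "mon t \<in> I"
  using assms keys_in_monomial_span[of f _ t] unfolding monomial_ideal_def
  by (auto simp: mon_in_span_iff)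

lemma expv_degree_eq_sum:
  assumes "finite V" "Poly_Mapping.keys t \<subseteq> V"
  shows "expv_degree t = (\<Sum>v\<in>V. Poly_Mapping.lookup t v)"
  unfolding expv_degree_def
  by (rule sum.mono_neutral_left) (use assms in \<open>auto simp: in_keys_iff\<close>)

lemma expv_degree_add: "expv_degree (s + t) = expv_degree s + expv_degree t"
proof -
  let ?V = "Poly_Mapping.keys s \<union> Poly_Mapping.keys t"
  have "expv_degree (s + t) = (\<Sum>v\<in>?V. Poly_Mapping.lookup (s + t) v)"
    by (intro expv_degree_eq_sum Poly_Mapping.keys_add) simp
  then show ?thesis
    by (simp add: expv_degree_eq_sum[of ?V s] expv_degree_eq_sum[of ?V t] lookup_add sum.distrib)
qed

lemma expv_degree_eq_0_iff: "expv_degree t = 0 \<longleftrightarrow> t = 0"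
  by (auto simp: expv_degree_def in_keys_iff intro: poly_mapping_eqI)

lemma degree_part_ideal_eq_span:
  assumes "monomial_ideal I"
  shows "degree_part_ideal I d = ideal.span (mon ` {t. expv_degree t = d \<and> mon t \<in> I})"
proof -
  let ?D = "{t. expv_degree t = d \<and> mon t \<in> I}"
  have "{f \<in> I. homogeneous d f} \<subseteq> ideal.span (mon ` ?D)"
  proof
    fix f assume f: "f \<in> {f \<in> I. homogeneous d f}"
    show "f \<in> ideal.span (mon ` ?D)"
    proof (rule in_span_if_keys)
      fix t assume "t \<in> Poly_Mapping.keys f"
      with f have "t \<in> ?D"
        using keys_in_monomial_ideal[OF assms] by (auto simp: homogeneous_def)
      then show "mon t \<in> ideal.span (mon ` ?D)"
        by (intro ideal.span_base imageI)
    qed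
  qed
  moreover have "mon ` ?D \<subseteq> ideal.span {f \<in> I. homogeneous d f}"
    by (auto simp: homogeneous_def mon_def intro!: ideal.span_base)
  ultimately show ?thesis
    unfolding degree_part_ideal_def by (simp add: ideal.span_minimal subset_antisym)
qed

lemma min_gens_degree_part:
  fixes I :: "('v, 'k::field) mpoly set"
  assumes "monomial_ideal I"
  shows "min_gens (degree_part_ideal I d) = {t. expv_degree t = d \<and> mon t \<in> I}"
proof -
  define D where "D = {t. expv_degree t = d \<and> (mon t :: ('v, 'k) mpoly) \<in> I}"
  define J where "J = degree_part_ideal I d"
  have J: "J = ideal.span (mon ` D)"
    unfolding J_def D_def by (rule degree_part_ideal_eq_span[OF assms])
  have dvd_eq: "s = 0" if "s + a \<in> D" "a \<in> D" for s a
    using that by (auto simp: D_def expv_degree_add expv_degree_eq_0_iff)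
  show ?thesis
    unfolding min_gens_def J_def[symmetric] D_def[symmetric]
  proof (rule the_equality, intro conjI allI impI)
    show "ideal.span (mon ` D) = J" by (simp add: J)
  next
    fix B assume B: "B \<subset> D"
    then obtain t where t: "t \<in> D" "t \<notin> B" by blast
    have "(mon t :: ('v, 'k) mpoly) \<notin> ideal.span (mon ` B)"
    proof
      assume "(mon t :: ('v, 'k) mpoly) \<in> ideal.span (mon ` B)"
      then obtain a s where "a \<in> B" "t = s + a" by (auto simp: mon_in_span_iff)
      with t B dvd_eq[of s a] show False by auto
    qed
    moreover have "mon t \<in> J" using t by (auto simp: J intro: ideal.span_base)
    ultimately show "ideal.span (mon ` B) \<noteq> J" by blast
  next
    fix A
    assume A: "ideal.span (mon ` A) = J \<and> (\<forall>B. B \<subset> A \<longrightarrow> ideal.span (mon ` B) \<noteq> J)"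
    \<comment> \<open>An element of \<open>D\<close> is a multiple of some element of \<open>A\<close>, itself a multiple of some element of
      \<open>D\<close>; by degree all three coincide.\<close>
    have "D \<subseteq> A"
    proof
      fix t assume t: "t \<in> D"
      then have "mon t \<in> ideal.span (mon ` A :: ('v, 'k) mpoly set)"
        using A by (auto simp: J intro: ideal.span_base)
      then obtain a s where a: "a \<in> A" "t = s + a" by (auto simp: mon_in_span_iff)
      have "(mon a :: ('v, 'k) mpoly) \<in> ideal.span (mon ` D)"
        using a A by (auto simp: J[symmetric] intro: ideal.span_base)
      then obtain a' s' where a': "a' \<in> D" "a = s' + a'" by (auto simp: mon_in_span_iff)
      have "expv_degree t = d" "expv_degree a' = d" using t a'(1) by (auto simp: D_def)
      then have "expv_degree s = 0" using a a' by (simp add: expv_degree_add)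
      then show "t \<in> A" using a by (simp add: expv_degree_eq_0_iff)
    qed
    with A J show "A = D" by blast
  qed
qed

lemma gen_matrix_eq_card:
  assumes "monomial_ideal I" "d \<ge> 1"
  shows "gen_matrix I i d = card {t. expv_degree t = d \<and> mon t \<in> I \<and> max_var t = i}"
proof -
  have "{t \<in> {t. expv_degree t = d \<and> mon t \<in> I}. t \<noteq> 0 \<and> max_var t = i} =
    {t. expv_degree t = d \<and> mon t \<in> I \<and> max_var t = i}"
    using assms(2) by (auto simp: expv_degree_def)
  then show ?thesis
    using assms(2) by (simp add: gen_matrix_def num_gens_def min_gens_degree_part[OF assms(1)])
qed

section \<open>Monomials in three variables\<close>

text \<open>The exponent vector of $x_1^a x_2^b x_3^c$.\<close>

definition mono3 :: "nat \<Rightarrow> nat \<Rightarrow> nat \<Rightarrow> var3 expv" where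
  "mono3 a b c = Poly_Mapping.single X1 a + Poly_Mapping.single X2 b + Poly_Mapping.single X3 c"

lemma lookup_mono3 [simp]:
  "Poly_Mapping.lookup (mono3 a b c) X1 = a"
  "Poly_Mapping.lookup (mono3 a b c) X2 = b"
  "Poly_Mapping.lookup (mono3 a b c) X3 = c"
  by (simp_all add: mono3_def lookup_add lookup_single)

lemma expv3_eq_iff:
  "s = t \<longleftrightarrow> (\<forall>v\<in>{X1, X2, X3}. Poly_Mapping.lookup s v = Poly_Mapping.lookup t v)"
proof -
  have "s = t" if "\<forall>v\<in>{X1, X2, X3}. Poly_Mapping.lookup s v = Poly_Mapping.lookup t v"
    by (rule poly_mapping_eqI, case_tac k) (use that in auto)
  then show ?thesis by blast
qed

lemma mono3_eq_iff [simp]: "mono3 a b c = mono3 a' b' c' \<longleftrightarrow> a = a' \<and> b = b' \<and> c = c'"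
  by (auto simp: expv3_eq_iff)

lemma expv3_cases: obtains a b c where "t = mono3 a b c"
  using expv3_eq_iff[of t "mono3 (Poly_Mapping.lookup t X1) (Poly_Mapping.lookup t X2)
    (Poly_Mapping.lookup t X3)"] by auto

lemma mono3_add: "mono3 a b c + mono3 a' b' c' = mono3 (a + a') (b + b') (c + c')"
  by (simp add: expv3_eq_iff lookup_add)

lemma keys_mono3:
  "Poly_Mapping.keys (mono3 a b c) =
     (if a = 0 then {} else {X1}) \<union> (if b = 0 then {} else {X2}) \<union> (if c = 0 then {} else {X3})"
proof -
  have "v \<in> Poly_Mapping.keys (mono3 a b c) \<longleftrightarrow> v \<in> (if a = 0 then {} else {X1}) \<union>
      (if b = 0 then {} else {X2}) \<union> (if c = 0 then {} else {X3})" for v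
    by (cases v) (auto simp: in_keys_iff)
  then show ?thesis by blast
qed

lemma expv_degree_mono3: "expv_degree (mono3 a b c) = a + b + c"
  by (subst expv_degree_eq_sum[of "{X1, X2, X3}"]) (auto simp: keys_mono3)

lemma var3_less [simp]:
  "X1 < X2" "X1 < X3" "X2 < X3"
  by (simp_all add: less_var3_def)

lemma max_var_mono3:
  assumes "0 < a + b + c"
  shows "max_var (mono3 a b c) = (if 0 < c then X3 else if 0 < b then X2 else X1)"
  unfolding max_var_def
  by (rule Max_eqI) (use assms in \<open>auto simp: keys_mono3 less_eq_var3_def split: if_splits\<close>)

section \<open>Stable sets of pairs\<close>

text \<open>
  A set of monomials of a fixed degree \<open>d\<close> is encoded by the pairs $(b,c)$ with
  $x_1^{d-b-c} x_2^b x_3^c$ in the set. The two closure conditions express the exchanges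
  $x_2\to x_1$ and $x_3\to x_2$; the exchange $x_3\to x_1$ is their composition. The degree does not
  occur in them.
\<close>

definition stable_pairs :: "(nat \<times> nat) set \<Rightarrow> bool" where
  "stable_pairs E \<longleftrightarrow> (\<forall>b c. ((Suc b, c) \<in> E \<longrightarrow> (b, c) \<in> E) \<and>
     ((b, Suc c) \<in> E \<longrightarrow> (Suc b, c) \<in> E))"

lemma stable_pairs_empty: "stable_pairs {}"
  by (simp add: stable_pairs_def)

lemma stable_pairsD:
  assumes "stable_pairs E"
  shows "(Suc b, c) \<in> E \<Longrightarrow> (b, c) \<in> E" and "(b, Suc c) \<in> E \<Longrightarrow> (Suc b, c) \<in> E"
  using assms unfolding stable_pairs_def by blast+

text \<open>For \<open>n = d\<close>, the pairs that encode all monomials of degree \<open>d\<close>.\<close>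

definition triangle :: "nat \<Rightarrow> (nat \<times> nat) set" where
  "triangle n = {(b, c). b + c \<le> n}"

text \<open>
  The pairs in \<open>E\<close> whose monomial has largest variable \<open>i\<close>. The pair \<open>(0, 0)\<close> encodes a power of
  \<open>X1\<close> and is counted for \<open>X1\<close>, which is correct in positive degree.
\<close>

fun pairs_with_max :: "var3 \<Rightarrow> (nat \<times> nat) set \<Rightarrow> (nat \<times> nat) set" where
  "pairs_with_max X1 E = {(b, c) \<in> E. b = 0 \<and> c = 0}"
| "pairs_with_max X2 E = {(b, c) \<in> E. 0 < b \<and> c = 0}"
| "pairs_with_max X3 E = {(b, c) \<in> E. 0 < c}"

section \<open>Strongly stable ideals as families of stable sets\<close>

text \<open>The pairs that encode the monomials of degree \<open>d\<close> in \<open>I\<close>.\<close>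

definition degree_pairs :: "(var3, 'k::field) mpoly set \<Rightarrow> nat \<Rightarrow> (nat \<times> nat) set" where
  "degree_pairs I d = {(b, c). b + c \<le> d \<and> mon (mono3 (d - b - c) b c) \<in> I}"

lemma gen_matrix_eq_card_pairs:
  fixes I :: "(var3, 'k::field) mpoly set"
  assumes "monomial_ideal I" "d \<ge> 1"
  shows "gen_matrix I i d = card (pairs_with_max i (degree_pairs I d))"
proof -
  let ?f = "\<lambda>(b, c). mono3 (d - b - c) b c"
  let ?P = "pairs_with_max i (degree_pairs I d)"
  have pairs: "(b, c) \<in> ?P \<longleftrightarrow> b + c \<le> d \<and> mon (mono3 (d - b - c) b c) \<in> I \<and>
      max_var (mono3 (d - b - c) b c) = i" for b c
    using assms(2) by (cases i) (auto simp: degree_pairs_def max_var_mono3 split: if_splits)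
  have "{t. expv_degree t = d \<and> mon t \<in> I \<and> max_var t = i} = ?f ` ?P" (is "?L = _")
  proof
    show "?L \<subseteq> ?f ` ?P"
    proof
      fix t assume t: "t \<in> ?L"
      obtain a b c where abc: "t = mono3 a b c" by (rule expv3_cases)
      with t have "a = d - b - c" "b + c \<le> d" by (auto simp: expv_degree_mono3)
      with t abc have "(b, c) \<in> ?P" "t = ?f (b, c)" by (auto simp: pairs)
      then show "t \<in> ?f ` ?P" by blast
    qed
    show "?f ` ?P \<subseteq> ?L"
      by (auto simp: pairs expv_degree_mono3)
  qed
  moreover have "inj_on ?f ?P" by (auto simp: inj_on_def)
  ultimately show ?thesis
    by (simp add: gen_matrix_eq_card[OF assms] card_image)
qed

lemma mon_add_in:
  assumes "monomial_ideal I" "mon t \<in> I"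
  shows "mon (s + t) \<in> I"
  using assms unfolding monomial_ideal_def by (auto simp: mon_add intro: ideal.span_scale)

text \<open>Closure of \<open>I\<close> under multiplication by \<open>X3\<close>.\<close>

lemma degree_pairs_Suc:
  assumes "monomial_ideal I" "(b, c) \<in> degree_pairs I d"
  shows "(b, Suc c) \<in> degree_pairs I (Suc d)"
proof -
  have "mono3 0 0 1 + mono3 (d - b - c) b c = mono3 (Suc d - b - Suc c) b (Suc c)"
    by (simp add: mono3_add)
  then show ?thesis
    using assms mon_add_in[of I "mono3 (d - b - c) b c" "mono3 0 0 1"]
    by (auto simp: degree_pairs_def)
qed

lemma stable_degree_pairs:
  assumes "strongly_stable I"
  shows "stable_pairs (degree_pairs I d)"
  unfolding stable_pairs_def
proof (intro allI conjI impI)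
  have move: "mon (mono3 a b c - Poly_Mapping.single j 1 + Poly_Mapping.single i 1) \<in> I"
    if "mon (mono3 a b c) \<in> I" "j \<in> Poly_Mapping.keys (mono3 a b c)" "i < j" for a b c i j
    using assms that unfolding strongly_stable_def by blast
  fix b c
  {
    assume E: "(Suc b, c) \<in> degree_pairs I d"
    have "mono3 (d - Suc b - c) (Suc b) c - Poly_Mapping.single X2 1 + Poly_Mapping.single X1 1
        = mono3 (d - b - c) b c"
      using E by (auto simp: expv3_eq_iff lookup_add lookup_minus lookup_single degree_pairs_def)
    with E move[of "d - Suc b - c" "Suc b" c X2 X1] show "(b, c) \<in> degree_pairs I d"
      by (auto simp: degree_pairs_def keys_mono3)
  next
    assume E: "(b, Suc c) \<in> degree_pairs I d"
    have "mono3 (d - b - Suc c) b (Suc c) - Poly_Mapping.single X3 1 + Poly_Mapping.single X2 1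
        = mono3 (d - Suc b - c) (Suc b) c"
      using E by (auto simp: expv3_eq_iff lookup_add lookup_minus lookup_single degree_pairs_def)
    with E move[of "d - b - Suc c" b "Suc c" X3 X2] show "(Suc b, c) \<in> degree_pairs I d"
      by (auto simp: degree_pairs_def keys_mono3)
  }
qed

text \<open>The ideal generated by the monomials that the sets \<open>E d\<close> encode in each degree \<open>d\<close>.\<close>

definition pairs_ideal :: "(nat \<Rightarrow> (nat \<times> nat) set) \<Rightarrow> (var3, 'k::field) mpoly set" where
  "pairs_ideal E = ideal.span (mon ` {mono3 a b c | a b c. (b, c) \<in> E (a + b + c)})"

lemma monomial_ideal_pairs_ideal: "monomial_ideal (pairs_ideal E)"
  by (auto simp: monomial_ideal_def pairs_ideal_def)

text \<open>
  A family of stable sets, one in each degree, that is closed under multiplication by \<open>X3\<close>, and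
  therefore, by stability, under multiplication by every variable.
\<close>

locale graded_stable =
  fixes E :: "nat \<Rightarrow> (nat \<times> nat) set"
  assumes stable: "stable_pairs (E d)"
    and grow: "(b, c) \<in> E d \<Longrightarrow> (b, Suc c) \<in> E (Suc d)"
begin

lemma stepX2: "(Suc b, c) \<in> E d \<Longrightarrow> (b, c) \<in> E d"
  and stepX3: "(b, Suc c) \<in> E d \<Longrightarrow> (Suc b, c) \<in> E d"
  by (fact stable_pairsD[OF stable])+

text \<open>Closure under multiplication by $x_1^x x_2^y x_3^z$.\<close>

lemma grow_add: "(b, c) \<in> E d \<Longrightarrow> (b + y, c + z) \<in> E (d + x + y + z)"
proof -
  have X3: "(b, c + z) \<in> E (d + z)" if "(b, c) \<in> E d" for b c d
    by (induction z) (simp_all add: that grow)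
  have X2: "(b + y, c) \<in> E (d + y)" if "(b, c) \<in> E d" for b c d
    by (induction y) (simp_all add: that stepX3[OF grow])
  have X1: "(b, c) \<in> E (d + x)" if "(b, c) \<in> E d" for b c d
    by (induction x) (simp_all add: that stepX2[OF stepX3[OF grow]])
  show "(b, c) \<in> E d \<Longrightarrow> (b + y, c + z) \<in> E (d + x + y + z)"
    by (intro X1 X2 X3)
qed

text \<open>The ideal contains no monomials other than the encoded ones.\<close>

lemma mon_in_pairs_ideal_iff:
  "(mon (mono3 a b c) :: (var3, 'k::field) mpoly) \<in> pairs_ideal E \<longleftrightarrow> (b, c) \<in> E (a + b + c)"
proof
  assume "(mon (mono3 a b c) :: (var3, 'k) mpoly) \<in> pairs_ideal E"
  then obtain a' b' c' s where E: "(b', c') \<in> E (a' + b' + c')"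
    and s: "mono3 a b c = s + mono3 a' b' c'"
    unfolding pairs_ideal_def by (auto simp: mon_in_span_iff)
  obtain x y z where "s = mono3 x y z" by (rule expv3_cases)
  with s have "a = a' + x" "b = b' + y" "c = c' + z" by (auto simp: mono3_add)
  then show "(b, c) \<in> E (a + b + c)"
    using grow_add[OF E, of y z x] by (simp add: ac_simps)
next
  assume "(b, c) \<in> E (a + b + c)"
  then show "(mon (mono3 a b c) :: (var3, 'k) mpoly) \<in> pairs_ideal E"
    unfolding pairs_ideal_def by (auto intro: ideal.span_base)
qed

lemma strongly_stable_pairs_ideal: "strongly_stable (pairs_ideal E :: (var3, 'k::field) mpoly set)"
  unfolding strongly_stable_def
proof (intro conjI allI ballI impI)
  show "monomial_ideal (pairs_ideal E :: (var3, 'k) mpoly set)"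
    by (rule monomial_ideal_pairs_ideal)
next
  fix u j and i :: var3
  assume u: "(mon u :: (var3, 'k) mpoly) \<in> pairs_ideal E"
    and j: "j \<in> Poly_Mapping.keys u" and "i < j"
  obtain a b c where abc: "u = mono3 a b c" by (rule expv3_cases)
  have E: "(b, c) \<in> E (a + b + c)"
    using u by (simp add: abc mon_in_pairs_ideal_iff)
  consider "j = X2" "i = X1" | "j = X3" "i = X1" | "j = X3" "i = X2"
    using \<open>i < j\<close> by (cases i; cases j) (auto simp: less_var3_def)
  then show "(mon (u - Poly_Mapping.single j 1 + Poly_Mapping.single i 1) :: (var3, 'k) mpoly)
      \<in> pairs_ideal E"
  proof cases
    case 1
    with j obtain b' where b': "b = Suc b'"
      by (cases b) (auto simp: abc keys_mono3 split: if_splits)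
    have "u - Poly_Mapping.single j 1 + Poly_Mapping.single i 1 = mono3 (Suc a) b' c"
      by (auto simp: abc b' 1 expv3_eq_iff lookup_add lookup_minus lookup_single)
    moreover have "(b', c) \<in> E (Suc a + b' + c)"
      using stepX2[of b' c "a + b + c"] E by (simp add: b')
    ultimately show ?thesis by (simp only: mon_in_pairs_ideal_iff)
  next
    case 2
    with j obtain c' where c': "c = Suc c'"
      by (cases c) (auto simp: abc keys_mono3 split: if_splits)
    have "u - Poly_Mapping.single j 1 + Poly_Mapping.single i 1 = mono3 (Suc a) b c'"
      by (auto simp: abc c' 2 expv3_eq_iff lookup_add lookup_minus lookup_single)
    moreover have "(b, c') \<in> E (Suc a + b + c')"
      using stepX2[OF stepX3, of b c' "a + b + c"] E by (simp add: c')
    ultimately show ?thesis by (simp only: mon_in_pairs_ideal_iff)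
  next
    case 3
    with j obtain c' where c': "c = Suc c'"
      by (cases c) (auto simp: abc keys_mono3 split: if_splits)
    have "u - Poly_Mapping.single j 1 + Poly_Mapping.single i 1 = mono3 a (Suc b) c'"
      by (auto simp: abc c' 3 expv3_eq_iff lookup_add lookup_minus lookup_single)
    moreover have "(Suc b, c') \<in> E (a + Suc b + c')"
      using stepX3[of b c' "a + b + c"] E by (simp add: c')
    ultimately show ?thesis by (simp only: mon_in_pairs_ideal_iff)
  qed
qed

end

lemma degree_pairs_pairs_ideal:
  assumes "graded_stable E" "E d \<subseteq> triangle d"
  shows "degree_pairs (pairs_ideal E :: (var3, 'k::field) mpoly set) d = E d"
  using assms(2)
  by (auto simp: degree_pairs_def triangle_def graded_stable.mon_in_pairs_ideal_iff[OF assms(1)])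

section \<open>Counting and enlarging stable sets\<close>

lemma finite_triangle: "finite (triangle n)"
  by (rule finite_subset[of _ "{..n} \<times> {..n}"]) (auto simp: triangle_def)

lemma card_triangle: "card (triangle n) = Suc (Suc n) choose 2"
proof (induction n)
  case 0
  have "triangle 0 = {(0, 0)}" by (auto simp: triangle_def)
  then show ?case by (simp add: numeral_2_eq_2)
next
  case (Suc n)
  have "triangle (Suc n) = triangle n \<union> (\<lambda>b. (b, Suc n - b)) ` {..Suc n}"
    by (auto simp: triangle_def image_iff)
  moreover have "triangle n \<inter> (\<lambda>b. (b, Suc n - b)) ` {..Suc n} = {}"
    by (auto simp: triangle_def)
  moreover have "card ((\<lambda>b. (b, Suc n - b)) ` {..Suc n}) = Suc (Suc n)"
    by (subst card_image) (auto simp: inj_on_def)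
  ultimately show ?case
    using Suc by (simp add: card_Un_disjoint finite_triangle numeral_2_eq_2)
qed

lemma stable_triangle: "stable_pairs (triangle n)"
  by (auto simp: stable_pairs_def triangle_def)

text \<open>
  A stable set that is properly contained in a finite stable set \<open>T\<close> can be enlarged by one
  element of \<open>T\<close>, since an exchange lowers the weight $b+2c$ of a pair by one: an element of least
  weight outside the smaller set may be added.
\<close>

lemma stable_pairs_extend:
  assumes "stable_pairs P" "stable_pairs T" "finite T" "P \<subseteq> T" "card P \<le> n" "n \<le> card T"
  shows "\<exists>Q. stable_pairs Q \<and> P \<subseteq> Q \<and> Q \<subseteq> T \<and> card Q = n"
  using assms(5,6)
proof (induction n rule: dec_induct)
  case base
  then show ?case using assms by blast
next
  case (step n)
  then obtain Q where Q: "stable_pairs Q" "P \<subseteq> Q" "Q \<subseteq> T" "card Q = n" by auto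
  with step.prems have "\<exists>x. x \<in> T - Q"
    by (metis DiffI Suc_n_not_le_n subsetI subset_antisym)
  then obtain x where "x \<in> T - Q"
    and "\<And>y. y \<in> T - Q \<Longrightarrow> fst x + 2 * snd x \<le> fst y + 2 * snd y"
    using ex_has_least_nat[of "\<lambda>x. x \<in> T - Q" _ "\<lambda>x. fst x + 2 * snd x"] by blast
  then obtain b c where bc: "(b, c) \<in> T - Q"
    and least: "\<And>b' c'. (b', c') \<in> T - Q \<Longrightarrow> b + 2 * c \<le> b' + 2 * c'"
    by (cases x) fastforce
  have X2: "(b', c) \<in> Q" if "b = Suc b'" for b'
    using bc least[of b' c] stable_pairsD(1)[OF assms(2), of b' c] that by auto
  have X3: "(Suc b, c') \<in> Q" if "c = Suc c'" for c'
    using bc least[of "Suc b" c'] stable_pairsD(2)[OF assms(2), of b c'] that by auto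
  have "stable_pairs (insert (b, c) Q)"
    unfolding stable_pairs_def
  proof (intro allI conjI impI)
    fix b' c'
    show "(b', c') \<in> insert (b, c) Q" if "(Suc b', c') \<in> insert (b, c) Q"
      using that X2[of b'] stable_pairsD(1)[OF Q(1), of b' c'] by auto
    show "(Suc b', c') \<in> insert (b, c) Q" if "(b', Suc c') \<in> insert (b, c) Q"
      using that X3[of c'] stable_pairsD(2)[OF Q(1), of b' c'] by auto
  qed
  moreover have "card (insert (b, c) Q) = Suc n"
    using Q bc finite_subset[OF Q(3) assms(3)] by simp
  ultimately show ?case using Q bc by (intro exI[of _ "insert (b, c) Q"]) auto
qed

lemma finite_pairs_with_max: "finite E \<Longrightarrow> finite (pairs_with_max i E)"
  by (cases i) (auto intro: finite_subset[of _ E])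

lemma card_pairs_with_max:
  assumes "finite E"
  shows "card E = card (pairs_with_max X1 E) + card (pairs_with_max X2 E) + card (pairs_with_max X3 E)"
proof -
  have "E = pairs_with_max X1 E \<union> pairs_with_max X2 E \<union> pairs_with_max X3 E" by auto
  moreover have "card \<dots> =
      card (pairs_with_max X1 E) + card (pairs_with_max X2 E) + card (pairs_with_max X3 E)"
    by (subst card_Un_disjoint, (auto intro: finite_subset[OF _ assms])[3],
        subst card_Un_disjoint) (auto intro: finite_subset[OF _ assms])
  ultimately show ?thesis by simp
qed

lemma stable_pairs_closure:
  assumes "stable_pairs E" "(b, c) \<in> E"
  shows stable_pairs_row: "(b + c, 0) \<in> E" and stable_pairs_origin: "(0, 0) \<in> E"
    and stable_pairs_left: "b' \<le> b \<Longrightarrow> (b', c) \<in> E"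
proof -
  have left: "(b', c) \<in> E" if "b' \<le> b" "(b, c) \<in> E" for b b' c
    using that by (induction rule: inc_induct) (blast intro: stable_pairsD(1)[OF assms(1)])+
  show row: "(b + c, 0) \<in> E"
    using assms(2)
  proof (induction c arbitrary: b)
    case (Suc c)
    then have "(Suc b, c) \<in> E" by (intro stable_pairsD(2)[OF assms(1)])
    from Suc.IH[OF this] show ?case by simp
  qed simp
  show "(0, 0) \<in> E" using left[OF _ row] by simp
  show "b' \<le> b \<Longrightarrow> (b', c) \<in> E" using left assms(2) by blast
qed

text \<open>
  If $(b,c)\in E$, then $(b+c,0)\in E$ and hence $(1,0),\ldots,(b+c,0)\in E$, so that $b+c$ is at
  most the number of pairs in \<open>E\<close> with largest variable \<open>X2\<close>.
\<close>

lemma stable_pairs_subset_triangle: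
  assumes "stable_pairs E" "finite E"
  shows "E \<subseteq> triangle (card (pairs_with_max X2 E))"
proof
  fix x assume "x \<in> E"
  then obtain b c where bc: "x = (b, c)" "(b, c) \<in> E" by (cases x) auto
  have "(b', 0) \<in> E" if "b' \<le> b + c" for b'
    using stable_pairs_left[OF assms(1) stable_pairs_row[OF assms(1) bc(2)] that] .
  then have "(\<lambda>b'. (b', 0)) ` {1..b + c} \<subseteq> pairs_with_max X2 E" by auto
  moreover have "finite (pairs_with_max X2 E)" by (rule finite_pairs_with_max[OF assms(2)])
  ultimately have "card ((\<lambda>b'. (b', 0::nat)) ` {1..b + c}) \<le> card (pairs_with_max X2 E)"
    by (rule card_mono[rotated])
  moreover have "card ((\<lambda>b'. (b', 0::nat)) ` {1..b + c}) = b + c"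
    by (subst card_image) (auto simp: inj_on_def)
  ultimately show "x \<in> triangle (card (pairs_with_max X2 E))"
    using bc by (simp add: triangle_def)
qed

lemma pairs_with_max_X1:
  assumes "stable_pairs E"
  shows "card (pairs_with_max X1 E) = (if E = {} then 0 else 1)"
proof (cases "E = {}")
  case False
  then have "(0, 0) \<in> E" using stable_pairs_origin[OF assms] by (metis ex_in_conv prod.exhaust)
  then have "pairs_with_max X1 E = {(0, 0)}" by auto
  with False show ?thesis by simp
qed simp

text \<open>The pairs $(b,0)$ and the pairs $(b,c)$ with $c>0$ contribute one summand each.\<close>

lemma card_triangle_split: "card (triangle n) = Suc n + (Suc n choose 2)"
  by (simp add: card_triangle numeral_2_eq_2)

lemma stable_pairs_bound:
  assumes "stable_pairs E" "finite E" "E \<noteq> {}"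
  shows "card (pairs_with_max X3 E) \<le> Suc (card (pairs_with_max X2 E)) choose 2"
  using card_mono[OF finite_triangle stable_pairs_subset_triangle[OF assms(1,2)]]
    card_pairs_with_max[OF assms(2)] pairs_with_max_X1[OF assms(1)] assms(3)
  by (simp add: card_triangle_split)

text \<open>
  The sets \<open>E\<close> and \<open>E'\<close> stand for consecutive degrees. Multiplication by \<open>X2\<close> sends the monomials of
  \<open>E\<close> without \<open>X3\<close> to those of \<open>E'\<close> with largest variable \<open>X2\<close>; multiplication by \<open>X3\<close> sends all of
  \<open>E\<close> to those with largest variable \<open>X3\<close>.
\<close>

lemma pairs_growth:
  assumes "stable_pairs E'" "finite E" "finite E'"
    and grow: "\<And>b c. (b, c) \<in> E \<Longrightarrow> (b, Suc c) \<in> E'"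
  shows "card (pairs_with_max X1 E) + card (pairs_with_max X2 E) \<le> card (pairs_with_max X2 E')"
    and "card E \<le> card (pairs_with_max X3 E')"
proof -
  have "card (pairs_with_max X1 E) + card (pairs_with_max X2 E) =
      card (pairs_with_max X1 E \<union> pairs_with_max X2 E)"
    by (intro card_Un_disjoint[symmetric] finite_pairs_with_max assms(2)) auto
  also have "\<dots> = card ((\<lambda>(b, c). (Suc b, c)) ` (pairs_with_max X1 E \<union> pairs_with_max X2 E))"
    by (rule card_image[symmetric]) (auto simp: inj_on_def)
  also have "\<dots> \<le> card (pairs_with_max X2 E')"
    using stable_pairsD(2)[OF assms(1) grow] by (intro card_mono finite_pairs_with_max assms(3)) auto
  finally show "card (pairs_with_max X1 E) + card (pairs_with_max X2 E) \<le> card (pairs_with_max X2 E')" .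
  have "card E = card ((\<lambda>(b, c). (b, Suc c)) ` E)"
    by (rule card_image[symmetric]) (auto simp: inj_on_def)
  also have "\<dots> \<le> card (pairs_with_max X3 E')"
    using grow by (intro card_mono finite_pairs_with_max assms(3)) auto
  finally show "card E \<le> card (pairs_with_max X3 E')" .
qed

text \<open>
  The recursion step: under the numerical conditions, a stable set extends to a stable set of the
  next degree with prescribed nonzero row \<open>(1, m2, m3)\<close>. The pairs \<open>R\<close> are forced by \<open>m2\<close>, the pairs
  \<open>S\<close> by multiplication with \<open>X3\<close>.
\<close>

lemma stable_pairs_next:
  assumes E: "stable_pairs E" "finite E"
    and m2: "card (pairs_with_max X1 E) + card (pairs_with_max X2 E) \<le> m2"
    and m3: "card E \<le> m3" "m3 \<le> Suc m2 choose 2"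
  obtains E' where "stable_pairs E'" "E' \<subseteq> triangle m2" "\<And>b c. (b, c) \<in> E \<Longrightarrow> (b, Suc c) \<in> E'"
    "card (pairs_with_max X1 E') = 1" "card (pairs_with_max X2 E') = m2"
    "card (pairs_with_max X3 E') = m3"
proof -
  define R :: "(nat \<times> nat) set" where "R = (\<lambda>b. (b, 0)) ` {..m2}"
  define S where "S = (\<lambda>(b, c). (b, Suc c)) ` E"
  have bound: "Suc (b + c) \<le> m2" if "(b, c) \<in> E" for b c
    using stable_pairs_subset_triangle[OF E] that m2 pairs_with_max_X1[OF E(1)]
    by (force simp: triangle_def split: if_splits)
  have "card R = Suc m2"
    unfolding R_def by (subst card_image) (auto simp: inj_on_def)
  moreover have "card S = card E"
    unfolding S_def by (rule card_image) (auto simp: inj_on_def)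
  moreover have "finite R" "finite S" "R \<inter> S = {}"
    using E(2) by (auto simp: R_def S_def)
  ultimately have card: "card (R \<union> S) = Suc m2 + card E"
    by (simp add: card_Un_disjoint)
  have "stable_pairs (R \<union> S)"
    unfolding stable_pairs_def
  proof (intro allI conjI impI)
    fix b c
    show "(b, c) \<in> R \<union> S" if "(Suc b, c) \<in> R \<union> S"
      using that stable_pairsD(1)[OF E(1), of b "c - 1"] by (auto simp: R_def S_def)
    show "(Suc b, c) \<in> R \<union> S" if "(b, Suc c) \<in> R \<union> S"
    proof (cases c)
      case 0
      with that bound[of b 0] show ?thesis by (auto simp: R_def S_def)
    next
      case (Suc c')
      with that stable_pairsD(2)[OF E(1), of b c'] show ?thesis by (auto simp: R_def S_def)
    qed
  qed
  moreover have "R \<union> S \<subseteq> triangle m2"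
    using bound by (auto simp: R_def S_def triangle_def)
  moreover have "card (R \<union> S) \<le> Suc m2 + m3" "Suc m2 + m3 \<le> card (triangle m2)"
    using m3 card by (simp_all add: card_triangle_split)
  ultimately obtain E' where E': "stable_pairs E'" "R \<union> S \<subseteq> E'" "E' \<subseteq> triangle m2"
      "card E' = Suc m2 + m3"
    using stable_pairs_extend[OF _ stable_triangle finite_triangle] by metis
  have fin: "finite E'" using E'(3) finite_triangle finite_subset by blast
  have X1: "card (pairs_with_max X1 E') = 1"
    using E' pairs_with_max_X1[OF E'(1)] by (auto simp: R_def)
  \<comment> \<open>The triangle has no pair $(b,0)$ beyond those of \<open>R\<close>, so all added pairs have $c>0$.\<close>
  have "pairs_with_max X2 E' = (\<lambda>b. (b, 0)) ` {1..m2}"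
    using E'(2,3) by (auto simp: R_def triangle_def image_iff)
  then have X2: "card (pairs_with_max X2 E') = m2"
    by (simp add: card_image inj_on_def)
  have X3: "card (pairs_with_max X3 E') = m3"
    using card_pairs_with_max[OF fin] X1 X2 E'(4) by simp
  show thesis
    by (rule that[OF E'(1) E'(3) _ X1 X2 X3]) (use E'(2) in \<open>auto simp: S_def\<close>)
qed

section \<open>Characterisation of the matrices of generators\<close>

lemma macaulay_up_1: "macaulay_up a 1 = Suc a choose 2"
proof -
  have rep: "macaulay_rep a 1 k \<longleftrightarrow> k 1 = a" for k
    by (auto simp: macaulay_rep_def)
  show ?thesis
    unfolding macaulay_up_def rep
    by (rule the_equality) (auto intro: exI[of _ "\<lambda>_. a"] simp: numeral_2_eq_2)
qed

lemma O_sequence_3: "O_sequence [p, q, r] \<longleftrightarrow> p = 1 \<and> r \<le> Suc q choose 2"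
proof -
  have indices: "{2..length [p, q, r] - 1} = {2}" by auto
  show ?thesis
    unfolding O_sequence_def indices using macaulay_up_1[of q] by simp
qed

theorem corollary2p10:
  fixes \<mu> :: "var3 \<Rightarrow> nat \<Rightarrow> nat"
  assumes row0: "\<And>i. \<mu> i 0 = 0"
  shows "(\<exists>I :: (var3, 'k::field) mpoly set. strongly_stable I \<and> gen_matrix I = \<mu>) \<longleftrightarrow>
    (\<forall>j\<ge>1. (\<exists>i. \<mu> i j \<noteq> 0) \<longrightarrow> O_sequence [\<mu> X1 j, \<mu> X2 j, \<mu> X3 j] \<and> \<mu> X2 j \<le> j) \<and>
    (\<forall>j\<ge>1. \<mu> X2 j \<ge> \<mu> X1 (j - 1) + \<mu> X2 (j - 1) \<and>
            \<mu> X3 j \<ge> \<mu> X1 (j - 1) + \<mu> X2 (j - 1) + \<mu> X3 (j - 1))"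
    (is "?L \<longleftrightarrow> ?rows \<and> ?growth")
proof
  assume ?L
  then obtain I :: "(var3, 'k) mpoly set" where I: "strongly_stable I" "gen_matrix I = \<mu>" by blast
  have mi: "monomial_ideal I" using I(1) by (simp add: strongly_stable_def)
  \<comment> \<open>Row \<open>0\<close> of the matrix is zero even if \<open>I\<close> contains \<open>1\<close>, so the set of degree \<open>0\<close> is taken empty.\<close>
  define E where "E d = (if d = 0 then {} else degree_pairs I d)" for d
  have \<mu>: "\<mu> i d = card (pairs_with_max i (E d))" for i d
    using gen_matrix_eq_card_pairs[OF mi, of d i] row0 I(2) by (cases i) (auto simp: E_def)
  have tri: "E d \<subseteq> triangle d" for d
    by (auto simp: E_def degree_pairs_def triangle_def)
  have fin: "finite (E d)" for d
    using tri finite_triangle by (rule finite_subset)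
  have stable: "stable_pairs (E d)" for d
    using stable_degree_pairs[OF I(1)] by (simp add: E_def stable_pairs_empty)
  have grow: "(b, Suc c) \<in> E (Suc d)" if "(b, c) \<in> E d" for b c d
    using degree_pairs_Suc[OF mi] that by (auto simp: E_def split: if_splits)
  have ?rows
  proof (intro allI impI)
    fix j assume "\<exists>i. \<mu> i j \<noteq> 0"
    then obtain i where "card (pairs_with_max i (E j)) \<noteq> 0" unfolding \<mu> by blast
    then have ne: "E j \<noteq> {}" by (cases i) auto
    have "pairs_with_max X2 (E j) \<subseteq> (\<lambda>b. (b, 0)) ` {1..j}"
      using tri[of j] by (auto simp: triangle_def)
    then have "\<mu> X2 j \<le> card {1..j}"
      unfolding \<mu> by (rule surj_card_le[rotated]) simp
    then show "O_sequence [\<mu> X1 j, \<mu> X2 j, \<mu> X3 j] \<and> \<mu> X2 j \<le> j"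
      using stable_pairs_bound[OF stable fin ne] pairs_with_max_X1[OF stable, of j] ne
      by (simp add: O_sequence_3 \<mu>)
  qed
  moreover have ?growth
  proof (intro allI impI)
    fix j :: nat assume "j \<ge> 1"
    then obtain d where "j = Suc d" by (cases j) auto
    then show "\<mu> X2 j \<ge> \<mu> X1 (j - 1) + \<mu> X2 (j - 1) \<and>
            \<mu> X3 j \<ge> \<mu> X1 (j - 1) + \<mu> X2 (j - 1) + \<mu> X3 (j - 1)"
      using pairs_growth[OF stable fin fin grow, of d] card_pairs_with_max[OF fin, of d]
      by (simp add: \<mu>)
  qed
  ultimately show "?rows \<and> ?growth" by blast
next
  assume "?rows \<and> ?growth"
  then have rows: "\<mu> X1 j = 1 \<and> \<mu> X3 j \<le> Suc (\<mu> X2 j) choose 2 \<and> \<mu> X2 j \<le> j"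
      if "\<mu> i j \<noteq> 0" "j \<ge> 1" for i j
    using that unfolding O_sequence_3 by blast
  have growth: "\<mu> X1 d + \<mu> X2 d \<le> \<mu> X2 (Suc d)" "\<mu> X1 d + \<mu> X2 d + \<mu> X3 d \<le> \<mu> X3 (Suc d)" for d
    using \<open>?rows \<and> ?growth\<close>[THEN conjunct2, rule_format, of "Suc d"] by simp_all
  let ?row = "\<lambda>d E. stable_pairs E \<and> E \<subseteq> triangle d \<and> (\<forall>i. card (pairs_with_max i E) = \<mu> i d)"
  have "\<exists>E. \<forall>d. ?row d (E d) \<and> (\<forall>b c. (b, c) \<in> E d \<longrightarrow> (b, Suc c) \<in> E (Suc d))"
  proof (rule dependent_nat_choice)
    have "pairs_with_max i {} = {}" for i by (cases i) auto
    then have "?row 0 {}" by (simp add: stable_pairs_empty row0)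
    then show "\<exists>E. ?row 0 E" ..
  next
    fix E d assume E: "?row d E"
    have fin: "finite E" using E finite_triangle finite_subset by blast
    have card: "card E = \<mu> X1 d + \<mu> X2 d + \<mu> X3 d"
      using card_pairs_with_max[OF fin] E by (simp del: pairs_with_max.simps)
    show "\<exists>E'. ?row (Suc d) E' \<and> (\<forall>b c. (b, c) \<in> E \<longrightarrow> (b, Suc c) \<in> E')"
    proof (cases "\<exists>i. \<mu> i (Suc d) \<noteq> 0")
      case False
      \<comment> \<open>By the growth condition a zero row can only follow a zero row.\<close>
      then have "E = {}" using growth[of d] card fin by simp
      have "pairs_with_max i {} = {}" for i by (cases i) auto
      with False \<open>E = {}\<close> have "?row (Suc d) {}" by (simp add: stable_pairs_empty)
      with \<open>E = {}\<close> show ?thesis by blast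
    next
      case True
      then have row: "\<mu> X1 (Suc d) = 1" "\<mu> X3 (Suc d) \<le> Suc (\<mu> X2 (Suc d)) choose 2"
          "\<mu> X2 (Suc d) \<le> Suc d"
        using rows[of _ "Suc d"] by auto
      have "card (pairs_with_max X1 E) + card (pairs_with_max X2 E) \<le> \<mu> X2 (Suc d)"
        using growth(1)[of d] E by (simp del: pairs_with_max.simps)
      moreover have "card E \<le> \<mu> X3 (Suc d)"
        using growth(2)[of d] card by simp
      ultimately obtain E' where E': "stable_pairs E'" "E' \<subseteq> triangle (\<mu> X2 (Suc d))"
          "\<And>b c. (b, c) \<in> E \<Longrightarrow> (b, Suc c) \<in> E'" "card (pairs_with_max X1 E') = 1"
          "card (pairs_with_max X2 E') = \<mu> X2 (Suc d)" "card (pairs_with_max X3 E') = \<mu> X3 (Suc d)"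
        using stable_pairs_next[OF conjunct1[OF E] fin _ _ row(2)] by metis
      have "card (pairs_with_max i E') = \<mu> i (Suc d)" for i
        using E' row(1) by (cases i) auto
      moreover have "E' \<subseteq> triangle (Suc d)"
        using E'(2) row(3) by (auto simp: triangle_def)
      ultimately show ?thesis using E'(1,3) by blast
    qed
  qed
  then obtain E where E: "\<And>d. ?row d (E d)"
      and grow: "\<And>d b c. (b, c) \<in> E d \<Longrightarrow> (b, Suc c) \<in> E (Suc d)" by blast
  interpret graded_stable E by unfold_locales (use E grow in auto)
  have "gen_matrix (pairs_ideal E :: (var3, 'k) mpoly set) i d = \<mu> i d" for i d
  proof (cases "d = 0")
    case True
    then show ?thesis by (simp add: gen_matrix_def row0)
  next
    case False
    then show ?thesis
      using E by (simp add: gen_matrix_eq_card_pairs monomial_ideal_pairs_ideal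
          degree_pairs_pairs_ideal graded_stable_axioms)
  qed
  then show ?L using strongly_stable_pairs_ideal by blast
qed

end
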